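(* Let $\sigma$ be the topology on the real line $\mathbb{R}$ whose elements are the sets of the form $U\setminus M$, where $U$ is open and $M$ is meager in the usual topology of $\mathbb{R}$. Then player TWO has a winning $2$-tactic in the Banach-Mazur game $BM(\mathbb{R},\sigma)$.
   Context: For a topological space $(X,\tau)$, the Banach-Mazur game $BM(X,\tau)$ is played as follows. There is an inning for each positive integer $n$; in inning $n$ player ONE first chooses a nonempty open set $O_n$ and player TWO responds with a nonempty open set $T_n$. The rule is $O_{n+1}\subseteq T_n\subseteq O_n$ for all $n$. TWO wins the play $(O_1,T_1,O_2,T_2,\dots)$ if $\bigcap_{n\ge 1} O_n\neq\emptyset$; otherwise ONE wins. A $k$-tactic for TWO is a function $F$ assigning to each sequence $U_1\supseteq\dots\supseteq U_j$ ($1\le j\le k$) of nonempty open sets a nonempty open subset of $U_j$. It is winning if TWO wins every play in which $T_j=F(O_1,\dots,O_j)$ for $j\le k$ and $T_{n+k}=F(O_{n+1},\dots,O_{n+k})$ for all $n\geq 1$. *)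

theory Defs
  imports "HOL-Analysis.Analysis"
begin

section \<open>Meager sets\<close>

definition nowhere_dense :: "'a::topological_space set \<Rightarrow> bool" where
  "nowhere_dense S \<longleftrightarrow> interior (closure S) = {}"

definition meager :: "'a::topological_space set \<Rightarrow> bool" where
  "meager S \<longleftrightarrow> (\<exists>\<N>. countable \<N> \<and> (\<forall>N\<in>\<N>. nowhere_dense N) \<and> S = \<Union>\<N>)"

lemma nowhere_dense_subset: "nowhere_dense T \<Longrightarrow> S \<subseteq> T \<Longrightarrow> nowhere_dense S"
  unfolding nowhere_dense_def by (metis closure_mono interior_mono subset_empty)

lemma meager_empty: "meager {}"
  unfolding meager_def by (rule exI[of _ "{}"]) simp

lemma meager_subset:
  assumes "meager T" "S \<subseteq> T"
  shows "meager S"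
proof -
  obtain \<N> where \<N>: "countable \<N>" "\<forall>N\<in>\<N>. nowhere_dense N" "T = \<Union>\<N>"
    using assms(1) unfolding meager_def by blast
  have "S = \<Union>((\<lambda>N. N \<inter> S) ` \<N>)" using \<N>(3) assms(2) by blast
  moreover have "\<forall>N\<in>(\<lambda>N. N \<inter> S) ` \<N>. nowhere_dense N"
    using \<N>(2) by (auto intro: nowhere_dense_subset)
  moreover have "countable ((\<lambda>N. N \<inter> S) ` \<N>)" using \<N>(1) by simp
  ultimately show ?thesis
    unfolding meager_def by (intro exI conjI)
qed

lemma meager_Union:
  assumes "countable \<M>" "\<And>M. M \<in> \<M> \<Longrightarrow> meager M"
  shows "meager (\<Union>\<M>)"
proof -
  have "\<forall>M\<in>\<M>. \<exists>\<N>. countable \<N> \<and> (\<forall>N\<in>\<N>. nowhere_dense N) \<and> M = \<Union>\<N>"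
    using assms(2) unfolding meager_def by blast
  from bchoice[OF this] obtain f
    where f: "\<forall>M\<in>\<M>. countable (f M) \<and> (\<forall>N\<in>f M. nowhere_dense N) \<and> M = \<Union>(f M)"
    by blast
  have c: "\<And>M. M \<in> \<M> \<Longrightarrow> countable (f M)"
    and n: "\<And>M. M \<in> \<M> \<Longrightarrow> \<forall>N\<in>f M. nowhere_dense N"
    and e: "\<And>M. M \<in> \<M> \<Longrightarrow> \<Union>(f M) = M"
    using f by (fast, fast, metis)
  have "countable (\<Union>(f ` \<M>))" using assms(1) c by (rule countable_UN)
  moreover have "\<Union>\<M> = \<Union>(\<Union>(f ` \<M>))"
  proof -
    have "\<Union>(\<Union>(f ` \<M>)) = (\<Union>M\<in>\<M>. \<Union>(f M))" by blast
    also have "\<dots> = (\<Union>M\<in>\<M>. M)" by (rule SUP_cong) (simp_all add: e)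
    finally show ?thesis by simp
  qed
  moreover have "\<forall>N\<in>\<Union>(f ` \<M>). nowhere_dense N" using n by blast
  ultimately show ?thesis
    unfolding meager_def by (intro exI conjI)
qed

section \<open>The topology of open sets modulo meager sets\<close>

definition sigma_open :: "real set \<Rightarrow> bool" where
  "sigma_open S \<longleftrightarrow> (\<exists>U M. open U \<and> meager M \<and> S = U - M)"

definition sigma_topology :: "real topology" where
  "sigma_topology = topology sigma_open"

lemma istopology_sigma_open: "istopology sigma_open"
  unfolding istopology_def
proof (intro conjI allI impI)
  fix S T assume "sigma_open S" "sigma_open T"
  then obtain U M V N where *: "open U" "meager M" "S = U - M" "open V" "meager N" "T = V - N"
    unfolding sigma_open_def by blast
  have "meager (M \<union> N)"
    using meager_Union[of "{M, N}"] * by auto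
  moreover have "open (U \<inter> V)" using * by blast
  moreover have "S \<inter> T = (U \<inter> V) - (M \<union> N)" using * by blast
  ultimately show "sigma_open (S \<inter> T)"
    unfolding sigma_open_def by (intro exI conjI)
next
  fix \<K> assume "\<forall>K\<in>\<K>. sigma_open K"
  then have "\<forall>K\<in>\<K>. \<exists>U. \<exists>M. open U \<and> meager M \<and> K = U - M"
    unfolding sigma_open_def .
  from bchoice[OF this] obtain U
    where "\<forall>K\<in>\<K>. \<exists>M. open (U K) \<and> meager M \<and> K = U K - M" by blast
  from bchoice[OF this] obtain M
    where M: "\<forall>K\<in>\<K>. open (U K) \<and> meager (M K) \<and> K = U K - M K" by blast
  have UM: "open (U K)" "meager (M K)" "K = U K - M K" if "K \<in> \<K>" for K
    using M that by blast+
  obtain \<C> where \<C>: "\<C> \<subseteq> \<K>" "countable \<C>" "\<Union>(U ` \<C>) = \<Union>(U ` \<K>)"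
  proof -
    obtain \<F> where \<F>: "\<F> \<subseteq> U ` \<K>" "countable \<F>" "\<Union>\<F> = \<Union>(U ` \<K>)"
    proof (rule Lindelof[of "U ` \<K>"])
      show "open S" if "S \<in> U ` \<K>" for S using that UM(1) by auto
    qed
    obtain \<C> where "\<C> \<subseteq> \<K>" "countable \<C>" "\<F> = U ` \<C>"
      using \<F>(1,2) countable_subset_image[of \<F> U \<K>] by auto
    then show ?thesis using \<F>(3) that by simp
  qed
  define R where "R = \<Union>(U ` \<K>) - \<Union>\<K>"
  have "meager (\<Union>(M ` \<C>))"
    by (rule meager_Union) (use \<C>(1,2) UM(2) in auto)
  moreover have "R \<subseteq> \<Union>(M ` \<C>)"
  proof
    fix x assume "x \<in> R"
    then obtain K where K: "K \<in> \<C>" "x \<in> U K" "x \<notin> \<Union>\<K>"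
      unfolding R_def using \<C>(3) by blast
    then have "x \<notin> U K - M K" using UM(3)[of K] K(1,3) \<C>(1) by blast
    then show "x \<in> \<Union>(M ` \<C>)" using K by blast
  qed
  ultimately have "meager R" by (rule meager_subset)
  moreover have "open (\<Union>(U ` \<K>))" using UM(1) by blast
  moreover have "\<Union>\<K> = \<Union>(U ` \<K>) - R"
  proof -
    have "\<Union>\<K> \<subseteq> \<Union>(U ` \<K>)"
    proof
      fix x assume "x \<in> \<Union>\<K>"
      then obtain K where K: "K \<in> \<K>" "x \<in> K" by blast
      then have "x \<in> U K - M K" using UM(3)[OF K(1)] by blast
      then show "x \<in> \<Union>(U ` \<K>)" using K(1) by blast
    qed
    then show ?thesis unfolding R_def by blast
  qed
  ultimately show "sigma_open (\<Union>\<K>)"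
    unfolding sigma_open_def by (intro exI conjI)
qed

lemma openin_sigma_topology:
  "openin sigma_topology S \<longleftrightarrow> (\<exists>U M. open U \<and> meager M \<and> S = U - M)"
  by (simp add: sigma_topology_def topology_inverse'[OF istopology_sigma_open] sigma_open_def)

lemma topspace_sigma_topology: "topspace sigma_topology = UNIV"
proof -
  have "openin sigma_topology UNIV"
    unfolding openin_sigma_topology
    by (rule exI[of _ UNIV], rule exI[of _ "{}"]) (simp add: meager_empty)
  then have "UNIV \<subseteq> topspace sigma_topology" by (rule openin_subset)
  then show ?thesis by auto
qed

section \<open>The Banach-Mazur game\<close>

text \<open>
  Innings are numbered from 1, so the values of the sequences at 0 are irrelevant.
  Player ONE plays \<open>P n\<close> and player TWO plays \<open>Q n\<close> in inning \<open>n\<close>.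
\<close>

definition BM_play :: "'a topology \<Rightarrow> (nat \<Rightarrow> 'a set) \<Rightarrow> (nat \<Rightarrow> 'a set) \<Rightarrow> bool" where
  "BM_play X P Q \<longleftrightarrow>
     (\<forall>n\<ge>1. openin X (P n) \<and> P n \<noteq> {} \<and> openin X (Q n) \<and> Q n \<noteq> {} \<and>
            P (n + 1) \<subseteq> Q n \<and> Q n \<subseteq> P n)"

definition TWO_wins :: "(nat \<Rightarrow> 'a set) \<Rightarrow> (nat \<Rightarrow> 'a set) \<Rightarrow> bool" where
  "TWO_wins P Q \<longleftrightarrow> (\<Inter>n\<in>{1..}. P n) \<noteq> {}"

text \<open>
  The response function \<open>F\<close> takes a list of moves of ONE, earliest first; its values on lists
  outside the domain described here are irrelevant.
\<close>

definition tactic_for_TWO :: "'a topology \<Rightarrow> nat \<Rightarrow> ('a set list \<Rightarrow> 'a set) \<Rightarrow> bool" where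
  "tactic_for_TWO X k F \<longleftrightarrow>
     (\<forall>Us. 1 \<le> length Us \<and> length Us \<le> k \<and>
           (\<forall>U\<in>set Us. openin X U \<and> U \<noteq> {}) \<and> sorted_wrt (\<supseteq>) Us \<longrightarrow>
           openin X (F Us) \<and> F Us \<noteq> {} \<and> F Us \<subseteq> last Us)"

definition follows_tactic ::
  "nat \<Rightarrow> ('a set list \<Rightarrow> 'a set) \<Rightarrow> (nat \<Rightarrow> 'a set) \<Rightarrow> (nat \<Rightarrow> 'a set) \<Rightarrow> bool" where
  "follows_tactic k F P Q \<longleftrightarrow>
     (\<forall>j\<in>{1..k}. Q j = F (map P [1..<j + 1])) \<and>
     (\<forall>n\<ge>1. Q (n + k) = F (map P [n + 1..<n + k + 1]))"

definition winning_tactic_for_TWO :: "'a topology \<Rightarrow> nat \<Rightarrow> ('a set list \<Rightarrow> 'a set) \<Rightarrow> bool" where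
  "winning_tactic_for_TWO X k F \<longleftrightarrow>
     tactic_for_TWO X k F \<and>
     (\<forall>P Q. BM_play X P Q \<and> follows_tactic k F P Q \<longrightarrow> TWO_wins P Q)"

end

theory Submission
  imports Defs
begin

text \<open>
  Every meager set lies in a set \<open>H = (\<Union>p. E p)\<close> of a special form: fix a partition of the
  ternary digit positions into finite blocks and a digit sequence \<open>x\<close>, and let \<open>E p\<close> consist of
  the reals whose digits disagree with \<open>x\<close> on every block starting at or after \<open>p\<close>. These
  decompositions are coherent: if \<open>H \<inter> U \<subseteq> H'\<close> for some nonempty open \<open>U\<close>, then \<open>E p \<subseteq> E' p\<close>
  for all sufficiently large \<open>p\<close>.

  When ONE plays \<open>S = U - M\<close>, let \<open>H\<close> be such a hull of \<open>M\<close>. TWO answers with a small interval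
  minus \<open>H\<close>, which forces the next hull to contain \<open>H\<close> locally. From the last two moves TWO
  computes the threshold \<open>m\<close> from which their decompositions are coherent, and picks the interval
  disjoint from the current layer \<open>E (max m j)\<close>, where \<open>j\<close> is read off from the size of \<open>S\<close>
  and tends to infinity along the play. The closures of TWO's sets have a common point \<open>y\<close>. If
  \<open>y\<close> were in layer \<open>k\<close> of some hull, it would stay in layer \<open>k\<close> of all later hulls: it can
  never leave it through a threshold \<open>m > k\<close>, since \<open>y\<close> avoids layer \<open>m\<close> of the next hull. This
  contradicts \<open>j \<rightarrow> \<infinity>\<close>.
\<close>

section \<open>Ternary digits\<close>

definition digit :: "nat \<Rightarrow> real \<Rightarrow> int" where
  "digit i y = \<lfloor>3 ^ Suc i * y\<rfloor> mod 3"

lemma digit_bounds: "0 \<le> digit i y" "digit i y < 3"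
  by (simp_all add: digit_def)

lemma floor_Suc_digit: "\<lfloor>3 ^ Suc i * y\<rfloor> = 3 * \<lfloor>3 ^ i * y\<rfloor> + digit i y"
proof -
  have "\<lfloor>3 ^ i * y\<rfloor> = \<lfloor>(3 ^ Suc i * y) / real_of_int 3\<rfloor>" by simp
  also have "\<dots> = \<lfloor>3 ^ Suc i * y\<rfloor> div 3" by (rule floor_divide_real_eq_div) simp
  finally show ?thesis by (simp add: digit_def)
qed

text \<open>Two reals with equal floors at scale \<open>3 ^ p\<close> share a half-open triadic cell
  of level \<open>p\<close>; each further digit selects one of three subcells.\<close>

lemma floor_eq_if_digits_eq:
  assumes "\<lfloor>3 ^ p * y\<rfloor> = \<lfloor>3 ^ p * w\<rfloor>" "\<And>i. p \<le> i \<Longrightarrow> i < q \<Longrightarrow> digit i y = digit i w" "p \<le> q"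
  shows "\<lfloor>3 ^ q * y\<rfloor> = \<lfloor>3 ^ q * w\<rfloor>"
  using assms(3,2)
proof (induction q rule: dec_induct)
  case base
  then show ?case using assms(1) by simp
next
  case (step n)
  have "\<lfloor>3 ^ n * y\<rfloor> = \<lfloor>3 ^ n * w\<rfloor>" using step.IH step.prems by simp
  moreover have "digit n y = digit n w" using step by simp
  ultimately show ?case by (simp only: floor_Suc_digit)
qed

lemma dist_less_if_floor_eq:
  fixes y w :: real
  assumes "\<lfloor>3 ^ q * y\<rfloor> = \<lfloor>3 ^ q * w\<rfloor>"
  shows "dist y w < 1 / 3 ^ q"
proof -
  have "\<bar>3 ^ q * y - 3 ^ q * w\<bar> < 1" using assms by linarith
  then have "3 ^ q * \<bar>y - w\<bar> < 1" by (simp add: right_diff_distrib [symmetric] abs_mult)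
  then show ?thesis by (simp add: dist_real_def field_simps)
qed

text \<open>Expansions ending in an infinite string of twos are never digit expansions, which is
  why the hypothesis \<open>freq\<close> is needed.\<close>

lemma real_with_digits:
  fixes c :: int and s :: "nat \<Rightarrow> int"
  assumes s: "\<And>i. 0 \<le> s i \<and> s i < 3" and freq: "\<And>m. \<exists>i\<ge>m. s i \<noteq> 2"
  obtains y where "\<lfloor>3 ^ p * y\<rfloor> = c" "\<And>i. p \<le> i \<Longrightarrow> digit i y = s i"
proof -
  \<comment> \<open>\<open>e j\<close> is the intended floor of \<open>3 ^ (p + j) * y\<close>;
    \<open>L j\<close> and \<open>R j\<close> are the ends of the corresponding nested
    cells.\<close>
  define e where "e = rec_nat c (\<lambda>j v. 3 * v + s (p + j))"
  have e0: "e 0 = c" and eS: "e (Suc j) = 3 * e j + s (p + j)" for j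
    by (simp_all add: e_def)
  define L where "L j = real_of_int (e j) / 3 ^ (p + j)" for j
  define R where "R j = (real_of_int (e j) + 1) / 3 ^ (p + j)" for j
  have LS: "L j \<le> L (Suc j)" for j
    using s[of "p + j"] by (simp add: L_def eS field_simps)
  have RS: "R (Suc j) \<le> R j" for j
  proof -
    have "real_of_int (s (p + j)) \<le> 2" using s[of "p + j"] by linarith
    then show ?thesis by (simp add: R_def eS field_simps)
  qed
  have RS': "R (Suc j) < R j" if "s (p + j) \<noteq> 2" for j
  proof -
    have "real_of_int (s (p + j)) < 2" using s[of "p + j"] that by linarith
    then show ?thesis by (simp add: R_def eS field_simps)
  qed
  have incL: "incseq L" and decR: "decseq R"
    using LS RS by (simp_all add: incseq_Suc_iff decseq_Suc_iff)
  have LR: "L j \<le> R k" for j k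
  proof -
    have "L j \<le> L (max j k)" using incL by (simp add: incseq_def)
    also have "\<dots> \<le> R (max j k)" by (simp add: L_def R_def divide_right_mono)
    also have "\<dots> \<le> R k" using decR by (simp add: decseq_def)
    finally show ?thesis .
  qed
  define y where "y = (SUP j. L j)"
  have bdd: "bdd_above (range L)" using LR by (auto intro!: bdd_aboveI[of _ "R 0"])
  have Ly: "L j \<le> y" for j
    unfolding y_def by (rule cSUP_upper) (use bdd in auto)
  have yR: "y \<le> R j" for j
    unfolding y_def by (rule cSUP_least) (use LR in auto)
  \<comment> \<open>Cells exclude their right end. A later digit other than 2 makes \<open>R\<close>
    drop strictly, so \<open>y\<close> cannot be that end.\<close>
  have yR': "y < R j" for j
  proof -
    obtain i where i: "i \<ge> p + j" "s i \<noteq> 2" using freq by blast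
    define k where "k = i - p"
    have k: "k \<ge> j" "s (p + k) \<noteq> 2" using i by (auto simp: k_def)
    have "y \<le> R (Suc k)" by (rule yR)
    also have "\<dots> < R k" by (rule RS') (rule k)
    also have "\<dots> \<le> R j" using decR k by (simp add: decseq_def)
    finally show ?thesis .
  qed
  have fl: "\<lfloor>3 ^ (p + j) * y\<rfloor> = e j" for j
  proof (rule floor_unique)
    show "real_of_int (e j) \<le> 3 ^ (p + j) * y"
      using Ly[of j] by (simp add: L_def divide_le_eq mult.commute)
    show "3 ^ (p + j) * y < real_of_int (e j) + 1"
      using yR'[of j] by (simp add: R_def less_divide_eq mult.commute)
  qed
  show ?thesis
  proof (rule that)
    show "\<lfloor>3 ^ p * y\<rfloor> = c" using fl[of 0] e0 by simp
    show "digit i y = s i" if "p \<le> i" for i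
    proof -
      have "\<lfloor>3 ^ Suc i * y\<rfloor> = e (Suc (i - p))" using fl[of "Suc (i - p)"] that by simp
      also have "\<dots> = 3 * e (i - p) + s i" using eS[of "i - p"] that by simp
      finally show ?thesis using s[of i] by (simp add: digit_def)
    qed
  qed
qed

section \<open>A coherent cofinal family of meager sets\<close>

text \<open>The blocks are the intervals \<open>{a k..<a (Suc k)}\<close>. The parameter \<open>p\<close> is a position among
  the digits and not a block number, so that sets belonging to different block
  partitions can be compared.\<close>

definition avoid_set :: "(nat \<Rightarrow> nat) \<Rightarrow> (nat \<Rightarrow> int) \<Rightarrow> nat \<Rightarrow> real set" where
  "avoid_set a x p = {y. \<forall>k. p \<le> a k \<longrightarrow> (\<exists>i\<in>{a k..<a (Suc k)}. digit i y \<noteq> x i)}"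

definition pattern :: "(nat \<Rightarrow> nat) \<Rightarrow> (nat \<Rightarrow> int) \<Rightarrow> bool" where
  "pattern a x \<longleftrightarrow> strict_mono a \<and> (\<forall>i. 0 \<le> x i \<and> x i < 3)"

lemma avoid_set_mono: "p \<le> q \<Longrightarrow> avoid_set a x p \<subseteq> avoid_set a x q"
  unfolding avoid_set_def by auto

lemma cell_in_open:
  fixes U :: "real set"
  assumes "open U" "w \<in> U"
  obtains q where "\<And>r (y::real). q \<le> r \<Longrightarrow> \<lfloor>3 ^ r * y\<rfloor> = \<lfloor>3 ^ r * w\<rfloor> \<Longrightarrow> y \<in> U"
proof -
  obtain \<epsilon> where e: "\<epsilon> > 0" "ball w \<epsilon> \<subseteq> U" using assms openE by blast
  obtain q where q: "(1 / 3 :: real) ^ q < \<epsilon>" using real_arch_pow_inv[OF e(1), of "1/3"] by auto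
  show ?thesis
  proof (rule that)
    fix r :: nat and y :: real assume r: "q \<le> r" "\<lfloor>3 ^ r * y\<rfloor> = \<lfloor>3 ^ r * w\<rfloor>"
    have "dist y w < 1 / 3 ^ r" using r by (intro dist_less_if_floor_eq)
    also have "\<dots> \<le> (1 / 3) ^ q"
      using power_decreasing[OF r(1), of "1/3::real"] by (simp add: power_one_over)
    finally show "y \<in> U" using q e(2) by (auto simp: dist_commute)
  qed
qed

lemma cell_interior:
  fixes c :: int
  obtains V :: "real set" where "open V" "V \<noteq> {}" "\<And>y. y \<in> V \<Longrightarrow> \<lfloor>3 ^ q * y\<rfloor> = c"
proof (rule that)
  let ?V = "{real_of_int c / 3 ^ q <..< (real_of_int c + 1) / 3 ^ q}"
  show "open ?V" by simp
  show "?V \<noteq> {}" by (simp add: not_le divide_strict_right_mono)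
  fix y assume "y \<in> ?V"
  then show "\<lfloor>3 ^ q * y\<rfloor> = c"
    by (intro floor_unique) (simp_all add: field_simps)
qed

text \<open>Any cell can be refined by copying \<open>x\<close> along one whole block at or after
  \<open>p\<close>. The refined cell misses the set and contains an open interval.\<close>

lemma nowhere_dense_avoid_set:
  assumes "pattern a x"
  shows "nowhere_dense (avoid_set a x p)"
  unfolding nowhere_dense_def
proof (rule ccontr)
  let ?E = "avoid_set a x p"
  have a: "strict_mono a" and x: "\<And>i. 0 \<le> x i \<and> x i < 3" using assms by (auto simp: pattern_def)
  assume "interior (closure ?E) \<noteq> {}"
  then obtain w where w: "w \<in> interior (closure ?E)" by blast
  then obtain q where q: "\<And>r y. q \<le> r \<Longrightarrow> \<lfloor>3 ^ r * y\<rfloor> = \<lfloor>3 ^ r * w\<rfloor> \<Longrightarrow> y \<in> interior (closure ?E)"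
    using cell_in_open[OF open_interior] by metis
  define k where "k = max p q"
  have k: "a k \<ge> p" "a k \<ge> q"
    using strict_mono_imp_increasing[OF a, of k] by (auto simp: k_def)
  have ak: "a k < a (Suc k)" using a by (simp add: strict_mono_Suc_iff)
  \<comment> \<open>The zeros after the block rule out a tail of twos.\<close>
  define s where "s i = (if i < a (Suc k) then x i else 0)" for i
  have "0 \<le> s i \<and> s i < 3" for i using x by (simp add: s_def)
  moreover have "\<exists>i\<ge>m. s i \<noteq> 2" for m by (rule exI[of _ "max m (a (Suc k))"]) (simp add: s_def)
  ultimately obtain y where y: "\<lfloor>3 ^ a k * y\<rfloor> = \<lfloor>3 ^ a k * w\<rfloor>" "\<And>i. a k \<le> i \<Longrightarrow> digit i y = s i"
    using real_with_digits[of s] by metis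
  obtain V :: "real set" where V: "open V" "V \<noteq> {}" "\<And>v. v \<in> V \<Longrightarrow> \<lfloor>3 ^ a (Suc k) * v\<rfloor> = \<lfloor>3 ^ a (Suc k) * y\<rfloor>"
    using cell_interior[of "a (Suc k)" "\<lfloor>3 ^ a (Suc k) * y\<rfloor>"] by blast
  have fl: "\<lfloor>3 ^ r * v\<rfloor> = \<lfloor>3 ^ r * y\<rfloor>" if "v \<in> V" "r \<le> a (Suc k)" for v r
    using that(2,1)
  proof (induction r rule: inc_induct)
    case base
    then show ?case by (rule V(3))
  next
    case (step n)
    then show ?case using floor_Suc_digit[of n v] floor_Suc_digit[of n y]
        digit_bounds[of n v] digit_bounds[of n y] by auto
  qed
  have dig: "digit i v = digit i y" if "v \<in> V" "i < a (Suc k)" for i v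
    using fl[of v "Suc i"] that by (simp add: digit_def)
  have "V \<inter> ?E = {}"
  proof -
    have "v \<notin> ?E" if "v \<in> V" for v
      unfolding avoid_set_def using k(1) dig[OF that] y(2) by (auto intro!: exI[of _ k] simp: s_def)
    then show ?thesis by blast
  qed
  then have "V \<inter> closure ?E = {}" using V(1) by (simp add: open_Int_closure_eq_empty)
  moreover obtain v where v: "v \<in> V" using V(2) by blast
  have "\<lfloor>3 ^ a k * v\<rfloor> = \<lfloor>3 ^ a k * w\<rfloor>" using fl[OF v, of "a k"] y(1) ak by simp
  then have "v \<in> interior (closure ?E)" using q k by blast
  then have "v \<in> closure ?E" using interior_subset by blast
  ultimately show False using v by blast
qed

definition hull_set :: "(nat \<Rightarrow> nat) \<times> (nat \<Rightarrow> int) \<Rightarrow> real set" where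
  "hull_set c = (\<Union>p. avoid_set (fst c) (snd c) p)"

lemma meager_hull_set:
  assumes "pattern (fst c) (snd c)"
  shows "meager (hull_set c)"
  unfolding meager_def hull_set_def
  by (rule exI[of _ "range (avoid_set (fst c) (snd c))"])
    (use nowhere_dense_avoid_set[OF assms] in auto)

text \<open>One of the two parity classes works. Leaving a free block after each chosen one keeps
  the chosen blocks from merging into longer intervals in \<open>hull_set_coherent\<close>.\<close>

lemma infinite_sparse_subset:
  fixes B :: "nat set"
  assumes "infinite B"
  obtains N where "N \<subseteq> B" "infinite N" "\<And>n. n \<in> N \<Longrightarrow> Suc n \<notin> N"
proof -
  have "B = {n\<in>B. even n} \<union> {n\<in>B. odd n}" by blast
  then have "infinite {n\<in>B. even n} \<or> infinite {n\<in>B. odd n}" using assms by (metis finite_Un)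
  then show ?thesis using that[of "{n\<in>B. even n}"] that[of "{n\<in>B. odd n}"] by auto
qed

text \<open>If infinitely many blocks of \<open>(b, z)\<close> contained no block of \<open>(a, x)\<close> on which \<open>x\<close> and \<open>z\<close>
  agree, then following \<open>z\<close> on infinitely many non-adjacent such blocks and differing
  from \<open>x\<close> everywhere else would give a point in the first set but not in the second.\<close>

lemma hull_set_coherent:
  assumes ax: "pattern a x" and bz: "pattern b z" and U: "open U" "U \<noteq> {}"
    and sub: "hull_set (a, x) \<inter> U \<subseteq> hull_set (b, z)"
  shows "\<exists>m. \<forall>p\<ge>m. avoid_set a x p \<subseteq> avoid_set b z p"
proof -
  have a: "strict_mono a" and b: "strict_mono b" and z: "\<And>i. 0 \<le> z i \<and> z i < 3"
    using ax bz by (auto simp: pattern_def)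
  have bS: "b n < b (Suc n)" and aS: "a n < a (Suc n)" for n
    using a b by (simp_all add: strict_mono_Suc_iff)
  \<comment> \<open>On a good block, differing from \<open>x\<close> on the inner block forces a
    difference from \<open>z\<close>.\<close>
  define good where "good n \<longleftrightarrow> (\<exists>k. b n \<le> a k \<and> a (Suc k) \<le> b (Suc n) \<and>
    (\<forall>i\<in>{a k..<a (Suc k)}. x i = z i))" for n
  have "finite {n. \<not> good n}"
  proof (rule ccontr)
    assume "infinite {n. \<not> good n}"
    then obtain N where N: "N \<subseteq> {n. \<not> good n}" "infinite N" "\<And>n. n \<in> N \<Longrightarrow> Suc n \<notin> N"
      using infinite_sparse_subset by blast
    \<comment> \<open>Off the chosen blocks the digit must differ from \<open>x\<close>; only 0 and
      1 are used, so that \<open>freq\<close> can be met there.\<close>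
    define s where "s i = (if \<exists>n\<in>N. i \<in> {b n..<b (Suc n)} then z i else if x i = 0 then 1 else 0)" for i
    have block: "n = n'" if "i \<in> {b n..<b (Suc n)}" "i \<in> {b n'..<b (Suc n')}" for i n n'
    proof (rule ccontr)
      assume "n \<noteq> n'"
      then have "Suc n \<le> n' \<or> Suc n' \<le> n" by auto
      then have "b (Suc n) \<le> b n' \<or> b (Suc n') \<le> b n" using b by (auto simp: strict_mono_less_eq)
      then show False using that by auto
    qed
    have large: "\<exists>n\<in>N. b n \<ge> m" for m
    proof -
      obtain n where "n \<in> N" "n \<ge> m" using N(2) unfolding infinite_nat_iff_unbounded_le by blast
      then show ?thesis using strict_mono_imp_increasing[OF b, of n] by (intro bexI[of _ n]) auto
    qed
    have s: "0 \<le> s i \<and> s i < 3" for i using z by (simp add: s_def)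
    \<comment> \<open>The position \<open>b (Suc n)\<close> opens the block right after a chosen
      one, and that block is not chosen.\<close>
    have freq: "\<exists>i\<ge>m. s i \<noteq> 2" for m
    proof -
      obtain n where n: "n \<in> N" "b n \<ge> m" using large by blast
      have "\<not> (\<exists>n'\<in>N. b (Suc n) \<in> {b n'..<b (Suc n')})"
        using block[of "b (Suc n)" "Suc n"] bS N(3)[OF n(1)] by fastforce
      then have "s (b (Suc n)) = (if x (b (Suc n)) = 0 then 1 else 0)"
        unfolding s_def by (rule if_not_P)
      then have "s (b (Suc n)) \<noteq> 2" by simp
      then show ?thesis using n(2) bS[of n] by (intro exI[of _ "b (Suc n)"]) auto
    qed
    obtain w where "w \<in> U" using U(2) by blast
    then obtain q where q: "\<And>y. \<lfloor>3 ^ q * y\<rfloor> = \<lfloor>3 ^ q * w\<rfloor> \<Longrightarrow> y \<in> U"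
      using cell_in_open[OF U(1)] by (metis order_refl)
    obtain y where y: "\<lfloor>3 ^ q * y\<rfloor> = \<lfloor>3 ^ q * w\<rfloor>" "\<And>i. q \<le> i \<Longrightarrow> digit i y = s i"
      using real_with_digits[OF s freq] by metis
    have "y \<in> avoid_set a x q"
      unfolding avoid_set_def
    proof (intro CollectI allI impI, rule ccontr)
      fix k assume k: "q \<le> a k" and "\<not> (\<exists>i\<in>{a k..<a (Suc k)}. digit i y \<noteq> x i)"
      then have eq: "s i = x i" if "i \<in> {a k..<a (Suc k)}" for i using y(2) that by auto
      have inN: "\<exists>n\<in>N. i \<in> {b n..<b (Suc n)}" if "i \<in> {a k..<a (Suc k)}" for i
        using eq[OF that] by (auto simp: s_def split: if_splits)
      obtain n where n: "n \<in> N" "a k \<in> {b n..<b (Suc n)}" using inN[of "a k"] aS by auto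
      \<comment> \<open>All positions of the \<open>a\<close>-block lie in chosen blocks. As the
        block after \<open>n\<close> is not chosen, the \<open>a\<close>-block cannot run past the
        end of block \<open>n\<close>.\<close>
      have le: "a (Suc k) \<le> b (Suc n)"
      proof (rule ccontr)
        assume "\<not> ?thesis"
        then have "b (Suc n) \<in> {a k..<a (Suc k)}" using n by auto
        then obtain n' where "n' \<in> N" "b (Suc n) \<in> {b n'..<b (Suc n')}" using inN by blast
        then show False using block[of "b (Suc n)" "Suc n" n'] bS N(3)[OF n(1)] by auto
      qed
      have "x i = z i" if i: "i \<in> {a k..<a (Suc k)}" for i
      proof -
        have "i \<in> {b n..<b (Suc n)}" using i le n(2) by auto
        then have "s i = z i" using n(1) by (auto simp: s_def)
        then show ?thesis using eq[OF i] by simp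
      qed
      then have "good n" unfolding good_def using le n(2) by (intro exI[of _ k]) auto
      then show False using N(1) n(1) by blast
    qed
    moreover have "y \<in> U" using q y(1) by blast
    ultimately obtain p where p: "y \<in> avoid_set b z p"
      using sub by (auto simp: hull_set_def)
    obtain n where n: "n \<in> N" "b n \<ge> max p q" using large by blast
    obtain i where i: "i \<in> {b n..<b (Suc n)}" "digit i y \<noteq> z i"
      using p n(2) by (auto simp: avoid_set_def)
    have "s i = z i" using i(1) n(1) by (auto simp: s_def)
    moreover have "q \<le> i" using i n by auto
    ultimately show False using y(2) i(2) by simp
  qed
  then obtain m0 where m0: "\<And>n. \<not> good n \<Longrightarrow> n < m0"
    using finite_nat_set_iff_bounded by auto
  show ?thesis
  \<comment> \<open>\<open>b m0\<close> turns the block index \<open>m0\<close> into a digit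
    position: each \<open>b\<close>-block starting at or after \<open>p\<close> is then good, and
    its inner \<open>a\<close>-block also starts at or after \<open>p\<close>.\<close>
  proof (intro exI[of _ "b m0"] allI impI subsetI)
    fix p y assume p: "b m0 \<le> p" and y: "y \<in> avoid_set a x p"
    show "y \<in> avoid_set b z p"
      unfolding avoid_set_def
    proof (intro CollectI allI impI)
      fix n assume n: "p \<le> b n"
      then have "b m0 \<le> b n" using p by simp
      then have "m0 \<le> n" using b by (simp add: strict_mono_less_eq)
      then have "good n" using m0 by force
      then obtain k where k: "b n \<le> a k" "a (Suc k) \<le> b (Suc n)" "\<And>i. i \<in> {a k..<a (Suc k)} \<Longrightarrow> x i = z i"
        unfolding good_def by blast
      obtain i where "i \<in> {a k..<a (Suc k)}" "digit i y \<noteq> x i"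
        using y k(1) n by (force simp: avoid_set_def)
      then show "\<exists>i\<in>{b n..<b (Suc n)}. digit i y \<noteq> z i" using k by (intro bexI[of _ i]) auto
    qed
  qed
qed

section \<open>Hulls for arbitrary meager sets\<close>

text \<open>One digit string serves all cells in \<open>C\<close>: it is lengthened for one cell at
  a time, each time into a subcell disjoint from \<open>G\<close>, and lengthening keeps what was
  achieved for the earlier cells.\<close>

lemma block_avoiding_nowhere_dense:
  assumes "finite C" and G: "nowhere_dense G"
  shows "\<exists>q>p. \<exists>x. (\<forall>i. 0 \<le> x i \<and> x i < (3::int)) \<and>
    (\<forall>y. \<lfloor>3 ^ p * y\<rfloor> \<in> C \<and> (\<forall>i\<in>{p..<q}. digit i y = x i) \<longrightarrow> y \<notin> G)"
  using assms(1)
proof (induction C)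
  case empty
  show ?case by (rule exI[of _ "Suc p"]) (auto intro: exI[of _ "\<lambda>_. 0"])
next
  case (insert c C)
  then obtain q x where q: "q > p" and x: "\<And>i. 0 \<le> x i \<and> x i < 3"
    and C: "\<And>y. \<lfloor>3 ^ p * y\<rfloor> \<in> C \<Longrightarrow> (\<And>i. i \<in> {p..<q} \<Longrightarrow> digit i y = x i) \<Longrightarrow> y \<notin> G"
    by blast
  define s where "s i = (if i < q then x i else 0)" for i
  have "0 \<le> s i \<and> s i < 3" for i using x by (simp add: s_def)
  moreover have "\<exists>i\<ge>m. s i \<noteq> 2" for m by (rule exI[of _ "max m q"]) (simp add: s_def)
  ultimately obtain v where v: "\<lfloor>3 ^ p * v\<rfloor> = c" "\<And>i. p \<le> i \<Longrightarrow> digit i v = s i"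
    using real_with_digits[of s] by metis
  obtain V :: "real set" where V: "open V" "V \<noteq> {}" "\<And>u. u \<in> V \<Longrightarrow> \<lfloor>3 ^ q * u\<rfloor> = \<lfloor>3 ^ q * v\<rfloor>"
    using cell_interior[of q "\<lfloor>3 ^ q * v\<rfloor>"] by blast
  have "\<not> V \<subseteq> closure G"
    using G V(1,2) interior_maximal[of V "closure G"] unfolding nowhere_dense_def by blast
  then obtain w where w: "w \<in> V - closure G" by blast
  have "open (V - closure G)" using V(1) by blast
  then obtain r0 where r0: "\<And>r y. r0 \<le> r \<Longrightarrow> \<lfloor>3 ^ r * y\<rfloor> = \<lfloor>3 ^ r * w\<rfloor> \<Longrightarrow> y \<in> V - closure G"
    using cell_in_open[OF _ w] by metis
  define r where "r = max r0 q"
  define x' where "x' i = (if i < q then x i else digit i w)" for i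
  have "y \<notin> G" if y: "\<lfloor>3 ^ p * y\<rfloor> \<in> insert c C" "\<And>i. i \<in> {p..<r} \<Longrightarrow> digit i y = x' i" for y
  proof -
    have yx: "digit i y = x i" if "i \<in> {p..<q}" for i
      using y(2)[of i] that by (simp add: x'_def r_def less_max_iff_disj)
    show ?thesis
    proof (cases "\<lfloor>3 ^ p * y\<rfloor> \<in> C")
      case True
      then show ?thesis using C yx by blast
    next
      case False
      then have "\<lfloor>3 ^ p * y\<rfloor> = \<lfloor>3 ^ p * v\<rfloor>" using y(1) v(1) by simp
      then have "\<lfloor>3 ^ q * y\<rfloor> = \<lfloor>3 ^ q * v\<rfloor>"
        by (rule floor_eq_if_digits_eq) (use v(2) yx q in \<open>auto simp: s_def\<close>)
      also have "\<dots> = \<lfloor>3 ^ q * w\<rfloor>" using V(3)[of w] w by simp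
      finally have "\<lfloor>3 ^ r * y\<rfloor> = \<lfloor>3 ^ r * w\<rfloor>"
        by (rule floor_eq_if_digits_eq) (use y(2) q in \<open>auto simp: x'_def r_def\<close>)
      then have "y \<in> V - closure G" using r0[of r y] by (simp add: r_def)
      then show ?thesis using closure_subset by blast
    qed
  qed
  moreover have "0 \<le> x' i \<and> x' i < 3" for i using x digit_bounds by (simp add: x'_def)
  moreover have "r > p" using q by (simp add: r_def)
  ultimately show ?case by (intro exI[of _ r] conjI exI[of _ x']) auto
qed

lemma nowhere_dense_Un:
  assumes "nowhere_dense S" "nowhere_dense T"
  shows "nowhere_dense (S \<union> T)"
  using assms unfolding nowhere_dense_def
  by (simp add: closure_Un interior_closed_Un_empty_interior)

lemma meager_increasing_cover:
  assumes "meager M"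
  obtains G :: "nat \<Rightarrow> 'a::topological_space set"
    where "\<And>n. nowhere_dense (G n)" "incseq G" "M = (\<Union>n. G n)"
proof -
  obtain \<N> where N: "countable \<N>" "\<forall>N\<in>\<N>. nowhere_dense N" "M = \<Union>\<N>"
    using assms unfolding meager_def by blast
  \<comment> \<open>Inserting the empty set makes the family nonempty, so that
    \<open>from_nat_into\<close> enumerates exactly it.\<close>
  define F where "F = from_nat_into (insert {} \<N>)"
  have rF: "range F = insert {} \<N>" unfolding F_def using N(1) by (simp add: range_from_nat_into)
  have F: "nowhere_dense (F n)" for n
  proof -
    have "F n \<in> insert {} \<N>" using rF by blast
    then show ?thesis using N(2) by (auto simp: nowhere_dense_def)
  qed
  show ?thesis
  proof (rule that)
    show "nowhere_dense (\<Union>i\<le>n. F i)" for n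
      by (induction n) (simp_all add: F atMost_Suc nowhere_dense_Un)
    show "incseq (\<lambda>n. \<Union>i\<le>n. F i)" by (force simp: incseq_def)
    have "M = \<Union>(range F)" using N(3) rF by simp
    then show "M = (\<Union>n. \<Union>i\<le>n. F i)" by auto
  qed
qed

text \<open>Block \<open>k\<close> is chosen so that following \<open>x\<close> on it keeps points
  of absolute value at most \<open>k\<close> out of \<open>G k\<close>. As \<open>G\<close>
  increases, a given point of \<open>G j\<close> must disagree with \<open>x\<close> on all late
  blocks.\<close>

lemma meager_subset_hull_set:
  assumes "meager M"
  shows "\<exists>c. pattern (fst c) (snd c) \<and> M \<subseteq> hull_set c"
proof -
  obtain G where G: "\<And>n. nowhere_dense (G n)" "incseq G" "M = (\<Union>n. G n)"
    using meager_increasing_cover[OF assms] by blast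
  \<comment> \<open>A finite set containing the level \<open>p\<close> cell indices of all reals of
    absolute value at most \<open>k\<close>.\<close>
  define C where "C p k = {- (3 ^ p * int k)..3 ^ p * int k}" for p k :: nat
  have "\<exists>q x. q > p \<and> (\<forall>i. 0 \<le> x i \<and> x i < (3::int)) \<and>
    (\<forall>y. \<lfloor>3 ^ p * y\<rfloor> \<in> C p k \<and> (\<forall>i\<in>{p..<q}. digit i y = x i) \<longrightarrow> y \<notin> G k)" for p k
    using block_avoiding_nowhere_dense[OF _ G(1), of "C p k" p k] by (auto simp: C_def)
  then obtain Q X where Q: "\<And>p k. Q p k > p" and X: "\<And>p k i. 0 \<le> X p k i \<and> X p k i < (3::int)"
    and QX: "\<And>p k y. \<lfloor>3 ^ p * y\<rfloor> \<in> C p k \<Longrightarrow> (\<And>i. i \<in> {p..<Q p k} \<Longrightarrow> digit i y = X p k i) \<Longrightarrow> y \<notin> G k"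
    by metis
  define a where "a = rec_nat 0 (\<lambda>k p. Q p k)"
  have aS: "a (Suc k) = Q (a k) k" for k by (simp add: a_def)
  have a: "strict_mono a" using Q by (simp add: strict_mono_Suc_iff aS)
  \<comment> \<open>The least such \<open>k\<close> is the index of the block containing
    \<open>i\<close>, since the blocks start at \<open>a 0 = 0\<close>.\<close>
  define x where "x i = (let k = LEAST k. i < a (Suc k) in X (a k) k i)" for i
  have xX: "x i = X (a k) k i" if "i \<in> {a k..<a (Suc k)}" for i k
  proof -
    have "(LEAST k. i < a (Suc k)) = k"
    proof (rule Least_equality)
      show "i < a (Suc k)" using that by simp
      fix j assume "i < a (Suc j)"
      then have "a k < a (Suc j)" using that by simp
      then show "k \<le> j" using a by (simp add: strict_mono_less)
    qed
    then show ?thesis by (simp add: x_def)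
  qed
  have "y \<in> hull_set (a, x)" if yM: "y \<in> M" for y
  proof -
    obtain j where j: "y \<in> G j" using G(3) yM by blast
    define K where "K = max j (nat \<lceil>\<bar>y\<bar>\<rceil>)"
    have "y \<in> avoid_set a x (a K)"
      unfolding avoid_set_def
    proof (intro CollectI allI impI, rule ccontr)
      fix k assume k: "a K \<le> a k" and neg: "\<not> (\<exists>i\<in>{a k..<a (Suc k)}. digit i y \<noteq> x i)"
      have Kk: "K \<le> k" using k a by (simp add: strict_mono_less_eq)
      have yk: "\<bar>y\<bar> \<le> real k" using Kk unfolding K_def by linarith
      have "\<bar>3 ^ a k * y\<bar> \<le> 3 ^ a k * real k"
        using yk by (simp add: abs_mult mult_left_mono)
      then have "3 ^ a k * y \<le> real_of_int (3 ^ a k * int k)"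
        "real_of_int (- (3 ^ a k * int k)) \<le> 3 ^ a k * y" by (auto simp: abs_le_iff)
      then have "\<lfloor>3 ^ a k * y\<rfloor> \<in> C (a k) k"
        unfolding C_def atLeastAtMost_iff le_floor_iff
        by (meson floor_le_iff le_floor_iff of_int_floor_le of_int_le_iff order_trans)
      moreover have "digit i y = X (a k) k i" if "i \<in> {a k..<Q (a k) k}" for i
        using neg xX[of i k] that by (auto simp: aS)
      ultimately have "y \<notin> G k" by (rule QX)
      moreover have "G j \<subseteq> G k" using G(2) Kk by (auto simp: incseq_def K_def)
      ultimately show False using j by blast
    qed
    then show ?thesis by (auto simp: hull_set_def)
  qed
  moreover have "0 \<le> x i \<and> x i < 3" for i using X by (simp add: x_def Let_def)
  ultimately show ?thesis using a by (intro exI[of _ "(a, x)"]) (auto simp: pattern_def)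
qed

section \<open>The replies of TWO\<close>

lemma open_diff_meager_nonempty:
  fixes U :: "real set"
  assumes "open U" "U \<noteq> {}" "meager M"
  shows "U - M \<noteq> {}"
proof
  assume "U - M = {}"
  obtain \<N> where N: "countable \<N>" "\<forall>N\<in>\<N>. nowhere_dense N" "M = \<Union>\<N>"
    using assms unfolding meager_def by blast
  let ?G = "(\<lambda>N. - closure N) ` \<N>"
  have "UNIV \<subseteq> closure (\<Inter>?G)"
  proof (rule Baire)
    show "countable ?G" using N(1) by (rule countable_image)
    fix T assume "T \<in> ?G"
    then obtain N where "N \<in> \<N>" "T = - closure N" by blast
    moreover from this have "interior (closure N) = {}" using N(2) by (simp add: nowhere_dense_def)
    ultimately show "openin (top_of_set UNIV) T \<and> UNIV \<subseteq> closure T"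
      by (simp add: closure_complement open_Compl)
  qed simp
  moreover have "U \<inter> \<Inter>?G = {}"
    using \<open>U - M = {}\<close> N(3) closure_subset by blast
  then have "U \<inter> closure (\<Inter>?G) = {}" using assms(1) by (simp add: open_Int_closure_eq_empty)
  ultimately show False using assms(2) by auto
qed

abbreviation sigma_move :: "real set \<Rightarrow> bool" where
  "sigma_move S \<equiv> openin sigma_topology S \<and> S \<noteq> {}"

text \<open>A move can be written as \<open>U - M\<close> in many ways. Fixing one by choice makes
  TWO's computations depend on the set alone.\<close>

definition support :: "real set \<Rightarrow> real set" where
  "support S = (SOME U. open U \<and> S \<subseteq> U \<and> meager (U - S))"

definition code :: "real set \<Rightarrow> (nat \<Rightarrow> nat) \<times> (nat \<Rightarrow> int)" where
  "code S = (SOME c. pattern (fst c) (snd c) \<and> support S - S \<subseteq> hull_set c)"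

abbreviation layer :: "real set \<Rightarrow> nat \<Rightarrow> real set" where
  "layer S \<equiv> avoid_set (fst (code S)) (snd (code S))"

lemma support:
  assumes "sigma_move S"
  shows "open (support S)" "S \<subseteq> support S" "meager (support S - S)"
proof -
  obtain U M where "open U" "meager M" "S = U - M" using assms by (auto simp: openin_sigma_topology)
  then have "open U \<and> S \<subseteq> U \<and> meager (U - S)" by (auto intro: meager_subset)
  then have "open (support S) \<and> S \<subseteq> support S \<and> meager (support S - S)"
    unfolding support_def by (rule someI)
  then show "open (support S)" "S \<subseteq> support S" "meager (support S - S)" by blast+
qed

lemma code:
  assumes "sigma_move S"
  shows "pattern (fst (code S)) (snd (code S))" "support S - S \<subseteq> hull_set (code S)"
  using someI_ex[OF meager_subset_hull_set[OF support(3)[OF assms]]] unfolding code_def by blast+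

text \<open>TWO replies to \<open>S\<close> by a set of diameter at most \<open>1 / Suc (fineness S)\<close>; hence fineness
  increases during a play and replaces the inning number, which TWO cannot see.\<close>

definition fineness :: "real set \<Rightarrow> nat" where
  "fineness S = (LEAST p. \<exists>y\<in>S. \<exists>w\<in>S. 1 / real (Suc p) \<le> dist y w)"

text \<open>Points are meager, so by Baire a move has a second point and the \<open>LEAST\<close> in
  \<open>fineness\<close> is attained.\<close>

lemma ex_dist_ge_fineness:
  assumes "sigma_move S"
  shows "\<exists>y\<in>S. \<exists>w\<in>S. 1 / real (Suc (fineness S)) \<le> dist y w"
proof -
  obtain y where y: "y \<in> S" using assms by blast
  have "nowhere_dense {y}" by (simp add: nowhere_dense_def)
  then have "meager {y}" unfolding meager_def by (intro exI[of _ "{{y}}"]) auto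
  then have "meager (\<Union>{support S - S, {y}})"
    using support(3)[OF assms] by (intro meager_Union) auto
  moreover have "support S \<noteq> {}" using assms support(2) by blast
  ultimately have "support S - \<Union>{support S - S, {y}} \<noteq> {}"
    using open_diff_meager_nonempty[OF support(1)[OF assms]] by blast
  then obtain w where w: "w \<in> S" "w \<noteq> y" by blast
  then have "0 < dist y w" by simp
  then obtain p where "inverse (real (Suc p)) < dist y w" using reals_Archimedean by blast
  then have "1 / real (Suc p) \<le> dist y w" by (simp add: inverse_eq_divide)
  then have "\<exists>y\<in>S. \<exists>w\<in>S. 1 / real (Suc p) \<le> dist y w" using y w(1) by blast
  then show ?thesis unfolding fineness_def by (rule LeastI)
qed

text \<open>A suitable \<open>m\<close> exists when the move \<open>S'\<close> lies in a reply to
  the move \<open>S\<close>; for other pairs the value may be arbitrary, and the reply is still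
  legal.\<close>

definition threshold :: "real set \<Rightarrow> real set \<Rightarrow> nat" where
  "threshold S S' = (SOME m. \<forall>p\<ge>m. layer S p \<subseteq> layer S' p)"

definition depth :: "real set \<Rightarrow> real set \<Rightarrow> nat" where
  "depth S S' = max (threshold S S') (fineness S')"

text \<open>The interval is closed because the limit point is only known to lie in the closures of
  TWO's sets, yet it must lie in the support and avoid the layer.\<close>

definition good_interval :: "real set \<Rightarrow> real set \<Rightarrow> real \<times> real \<Rightarrow> bool" where
  "good_interval S S' I \<longleftrightarrow> fst I < snd I \<and> {fst I..snd I} \<subseteq> support S' \<and>
     {fst I..snd I} \<inter> layer S' (depth S S') = {} \<and> snd I - fst I < 1 / real (Suc (fineness S'))"

definition reply_interval :: "real set \<Rightarrow> real set \<Rightarrow> real \<times> real" where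
  "reply_interval S S' = (SOME I. good_interval S S' I)"

definition reply :: "real set \<Rightarrow> real set \<Rightarrow> real set" where
  "reply S S' = {fst (reply_interval S S')<..<snd (reply_interval S S')} - hull_set (code S')"

lemma good_interval_reply_interval:
  assumes "sigma_move S'"
  shows "good_interval S S' (reply_interval S S')"
proof -
  let ?E = "layer S' (depth S S')"
  have ne: "support S' \<noteq> {}" using assms support(2) by blast
  have "interior (closure ?E) = {}"
    using nowhere_dense_avoid_set[OF code(1)[OF assms]] by (simp add: nowhere_dense_def)
  then have "\<not> support S' \<subseteq> closure ?E"
    using interior_maximal[of "support S'" "closure ?E"] support(1)[OF assms] ne by blast
  then obtain v where v: "v \<in> support S' - closure ?E" by blast
  have "open (support S' - closure ?E)" using support(1)[OF assms] by blast
  then obtain \<epsilon> where e: "\<epsilon> > 0" "cball v \<epsilon> \<subseteq> support S' - closure ?E"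
    using v open_contains_cball by blast
  define D where "D = 1 / real (Suc (fineness S'))"
  define \<delta> where "\<delta> = min \<epsilon> (D / 3)"
  have "D > 0" by (simp add: D_def)
  then have d: "\<delta> > 0" "\<delta> \<le> \<epsilon>" "2 * \<delta> < D" using e(1) by (auto simp: \<delta>_def min_def)
  have "{v - \<delta>..v + \<delta>} \<subseteq> cball v \<epsilon>" using d(2) by (auto simp: dist_real_def)
  then have sub: "{v - \<delta>..v + \<delta>} \<subseteq> support S' - closure ?E" using e(2) by blast
  then have "{v - \<delta>..v + \<delta>} \<inter> ?E = {}" using closure_subset[of ?E] by blast
  then have "good_interval S S' (v - \<delta>, v + \<delta>)"
    unfolding good_interval_def D_def [symmetric] using sub d by auto
  then show ?thesis unfolding reply_interval_def by (rule someI)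
qed

lemma reply:
  assumes "sigma_move S'"
  shows "sigma_move (reply S S')" "reply S S' \<subseteq> S'"
proof -
  have I: "good_interval S S' (reply_interval S S')" using assms by (rule good_interval_reply_interval)
  have m: "meager (hull_set (code S'))" using meager_hull_set code(1)[OF assms] by blast
  have "{fst (reply_interval S S')<..<snd (reply_interval S S')} \<noteq> {}"
    using I by (simp add: good_interval_def)
  then have "reply S S' \<noteq> {}"
    unfolding reply_def using m by (intro open_diff_meager_nonempty) auto
  moreover have "openin sigma_topology (reply S S')"
    unfolding reply_def openin_sigma_topology
    by (intro exI conjI, rule open_greaterThanLessThan, rule m, rule refl)
  ultimately show "sigma_move (reply S S')" by blast
  have "{fst (reply_interval S S')<..<snd (reply_interval S S')} \<subseteq> support S'"
    using I greaterThanLessThan_subseteq_atLeastAtMost_iff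
    by (fastforce simp: good_interval_def)
  then show "reply S S' \<subseteq> S'" unfolding reply_def using code(2)[OF assms] by blast
qed

lemma closure_reply:
  assumes "sigma_move S'"
  shows "compact (closure (reply S S'))" "closure (reply S S') \<subseteq> support S'"
    "closure (reply S S') \<inter> layer S' (depth S S') = {}"
proof -
  let ?I = "{fst (reply_interval S S')..snd (reply_interval S S')}"
  have I: "good_interval S S' (reply_interval S S')" using assms by (rule good_interval_reply_interval)
  have "reply S S' \<subseteq> ?I" by (auto simp: reply_def)
  then have sub: "closure (reply S S') \<subseteq> ?I" by (rule closure_minimal) simp
  then show "compact (closure (reply S S'))"
    by (metis bounded_closed_interval bounded_subset compact_eq_bounded_closed closed_closure)
  show "closure (reply S S') \<subseteq> support S'" "closure (reply S S') \<inter> layer S' (depth S S') = {}"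
    using sub I unfolding good_interval_def by blast+
qed

lemma fineness_increases:
  assumes "sigma_move S'" "sigma_move S''" "S'' \<subseteq> reply S S'"
  shows "fineness S' < fineness S''"
proof (rule ccontr)
  assume "\<not> ?thesis"
  then have le: "1 / real (Suc (fineness S')) \<le> 1 / real (Suc (fineness S''))"
    by (simp add: frac_le)
  obtain y w where yw: "y \<in> S''" "w \<in> S''" "1 / real (Suc (fineness S'')) \<le> dist y w"
    using ex_dist_ge_fineness[OF assms(2)] by blast
  let ?I = "reply_interval S S'"
  have "y \<in> {fst ?I<..<snd ?I}" "w \<in> {fst ?I<..<snd ?I}"
    using yw assms(3) by (auto simp: reply_def)
  then have "dist y w < snd ?I - fst ?I" by (auto simp: dist_real_def)
  moreover have "snd ?I - fst ?I < 1 / real (Suc (fineness S'))"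
    using good_interval_reply_interval[OF assms(1), of S] by (simp add: good_interval_def)
  ultimately show False using le yw(3) by linarith
qed

text \<open>Since \<open>S''\<close> avoids the hull of \<open>S'\<close>, every point of that hull
  inside \<open>support S''\<close> lies in \<open>support S'' - S''\<close>, thus in the hull of
  \<open>S''\<close>. Coherence applies on this open set.\<close>

lemma layer_subset_above_threshold:
  assumes "sigma_move S'" "sigma_move S''" "S'' \<subseteq> reply S S'" "threshold S' S'' \<le> p"
  shows "layer S' p \<subseteq> layer S'' p"
proof -
  have "S'' \<inter> hull_set (code S') = {}" using assms(3) by (auto simp: reply_def)
  then have "hull_set (code S') \<inter> support S'' \<subseteq> hull_set (code S'')"
    using code(2)[OF assms(2)] by blast
  moreover have "support S'' \<noteq> {}" using support(2)[OF assms(2)] assms(2) by blast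
  ultimately have "\<exists>m. \<forall>p\<ge>m. layer S' p \<subseteq> layer S'' p"
    using hull_set_coherent[OF code(1)[OF assms(1)] code(1)[OF assms(2)] support(1)[OF assms(2)]]
    by simp
  then have "\<forall>p\<ge>threshold S' S''. layer S' p \<subseteq> layer S'' p"
    unfolding threshold_def by (rule someI_ex)
  then show ?thesis using assms(4) by blast
qed

section \<open>Analysis of a play\<close>

theorem corollary43:
  shows "\<exists>F. winning_tactic_for_TWO sigma_topology 2 F"
proof
  \<comment> \<open>On a one-element list \<open>hd\<close> and \<open>last\<close> coincide, so in
    the first inning the current move stands in for the missing earlier one.\<close>
  let ?F = "\<lambda>Us. reply (hd Us) (last Us)"
  show "winning_tactic_for_TWO sigma_topology 2 ?F"
    unfolding winning_tactic_for_TWO_def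
  proof (intro conjI allI impI)
    show "tactic_for_TWO sigma_topology 2 ?F"
      unfolding tactic_for_TWO_def
    proof (intro allI impI, elim conjE)
      fix Us :: "real set list"
      assume "1 \<le> length Us" "\<forall>U\<in>set Us. openin sigma_topology U \<and> U \<noteq> {}"
      then have "sigma_move (last Us)" by (cases Us) auto
      then show "openin sigma_topology (?F Us) \<and> ?F Us \<noteq> {} \<and> ?F Us \<subseteq> last Us"
        using reply by blast
    qed
  next
    fix P Q assume "BM_play sigma_topology P Q \<and> follows_tactic 2 ?F P Q"
    then have play: "BM_play sigma_topology P Q" and follows: "follows_tactic 2 ?F P Q" by auto
    have P: "sigma_move (P n)" and Q: "Q n \<noteq> {}" and PQ: "P (Suc n) \<subseteq> Q n" "Q n \<subseteq> P n"
      if "n \<ge> 1" for n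
      using play that unfolding BM_play_def by auto
    define prev where "prev n = (if n = 1 then P 1 else P (n - 1))" for n :: nat
    have Qr: "Q n = reply (prev n) (P n)" if n: "n \<ge> 1" for n
    proof -
      consider "n = 1" | "n = 2" | "n \<ge> 3" using n by linarith
      then show ?thesis
      proof cases
        case 1
        then show ?thesis using follows by (auto simp: follows_tactic_def prev_def)
      next
        case 2
        have "\<forall>j\<in>{1..2}. Q j = ?F (map P [1..<j + 1])"
          using follows unfolding follows_tactic_def by (rule conjunct1)
        then have "Q 2 = ?F (map P [1..<2 + 1])" by (rule bspec) simp
        then show ?thesis using 2 by (simp add: prev_def numeral_2_eq_2 upt_rec)
      next
        case 3
        define m where "m = n - 2"
        have m: "n = m + 2" "m \<ge> 1" using 3 by (auto simp: m_def)
        then have "Q n = ?F (map P [m + 1..<m + 2 + 1])" using follows by (auto simp: follows_tactic_def)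
        then show ?thesis using m by (simp add: prev_def upt_rec)
      qed
    qed
    have next_in_reply: "P (Suc n) \<subseteq> reply (prev n) (P n)" if "n \<ge> 1" for n
      using PQ(1) Qr that by metis
    have fine: "n \<le> fineness (P (Suc n))" for n
    proof (induction n)
      case (Suc n)
      have "fineness (P (Suc n)) < fineness (P (Suc (Suc n)))"
        by (rule fineness_increases[OF _ _ next_in_reply]) (use P in auto)
      then show ?case using Suc by simp
    qed simp
    have decQ: "decseq (\<lambda>n. Q (Suc n))"
      unfolding decseq_Suc_iff
    proof
      show "Q (Suc (Suc n)) \<subseteq> Q (Suc n)" for n
        using PQ(2)[of "Suc (Suc n)"] PQ(1)[of "Suc n"] by auto
    qed
    have "(\<Inter>n. closure (Q (Suc n))) \<noteq> {}"
    proof (rule compact_nest)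
      show "compact (closure (Q (Suc n)))" for n
        using closure_reply(1) P Qr by simp
      show "closure (Q (Suc n)) \<noteq> {}" for n using Q by simp
      show "closure (Q (Suc n)) \<subseteq> closure (Q (Suc m))" if "m \<le> n" for m n
        using decQ that by (simp add: decseq_def closure_mono)
    qed
    then obtain y where yQ: "\<And>n. y \<in> closure (Q (Suc n))" by blast
    have y: "y \<in> closure (reply (prev n) (P n))" if "n \<ge> 1" for n
      using yQ[of "n - 1"] Qr[OF that] that by simp
    have "y \<in> P n" if n: "n \<ge> 1" for n
    proof (rule ccontr)
      assume "y \<notin> P n"
      moreover have "y \<in> support (P n)" using y[OF n] closure_reply(2)[OF P[OF n]] by blast
      ultimately have "y \<in> hull_set (code (P n))" using code(2)[OF P[OF n]] by blast
      then obtain k where k: "y \<in> layer (P n) k" by (auto simp: hull_set_def)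
      have notin: "y \<notin> layer (P r) (depth (prev r) (P r))" if "r \<ge> 1" for r
        using y[OF that] closure_reply(3)[OF P[OF that]] by blast
      have "y \<in> layer (P r) k" if "r \<ge> n" for r
        using that
      proof (induction r rule: dec_induct)
        case base
        then show ?case by (rule k)
      next
        case (step r)
        have r: "r \<ge> 1" using step n by simp
        let ?t = "threshold (P r) (P (Suc r))"
        have sub: "layer (P r) p \<subseteq> layer (P (Suc r)) p" if "?t \<le> p" for p
          by (rule layer_subset_above_threshold[OF _ _ next_in_reply that]) (use P r in auto)
        show ?case
        proof (cases "?t \<le> k")
          case True
          then show ?thesis using sub step.IH by blast
        next
          case False
          \<comment> \<open>Raising the layer to the threshold makes coherence applicable; the
            outcome contradicts \<open>notin\<close>, so this case is void.\<close>
          then have "y \<in> layer (P r) ?t" using step.IH avoid_set_mono[of k ?t] by auto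
          then have "y \<in> layer (P (Suc r)) ?t" using sub by blast
          \<comment> \<open>\<open>prev (Suc r)\<close> is \<open>P r\<close> because
            \<open>r \<ge> 1\<close>; seeing both moves, TWO has made the depth at least this
            threshold.\<close>
          moreover have "?t \<le> depth (prev (Suc r)) (P (Suc r))"
            using r by (simp add: depth_def prev_def)
          ultimately have "y \<in> layer (P (Suc r)) (depth (prev (Suc r)) (P (Suc r)))"
            using avoid_set_mono by blast
          then show ?thesis using notin[of "Suc r"] by simp
        qed
      qed
      \<comment> \<open>By \<open>fine\<close>, the depth in inning \<open>Suc (n + k)\<close> is at
        least \<open>k\<close>, whereas \<open>y\<close> avoids the layer at that depth.\<close>
      then have "y \<in> layer (P (Suc (n + k))) k" by simp
      moreover have "k \<le> depth (prev (Suc (n + k))) (P (Suc (n + k)))"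
        using fine[of "n + k"] by (simp add: depth_def)
      ultimately show False using notin[of "Suc (n + k)"] avoid_set_mono by fastforce
    qed
    then show "TWO_wins P Q" unfolding TWO_wins_def by auto
  qed
qed

end
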